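(* Let $P$ be the transition matrix of an absorbing Markov chain restricted to its finite set $\mathcal{T}$ of transient states, as in the context, and assume $P$ is diagonalizable. Let $\sigma:\mathcal{T}\to\mathcal{T}$ be an involution and $\kappa:\mathcal{T}\to(0,\infty)$ a positive weight obeying $\kappa(z)\kappa(\sigma(z))=K$ for all $z\in\mathcal{T}$, with $K$ a constant. The following are equivalent: (a) the spectral duality $B_\nu(z)=\kappa(z)\,A_\nu(\sigma(z))$ for all modes $\nu$; (b) the resolvent symmetry $\mathcal{R}\,R(\gamma)\,\mathcal{R}=\Delta^{-2}R(\gamma)\Delta^{2}$, i.e. $[\Delta^2\mathcal{R},R(\gamma)]=0$ for all $\gamma\in(0,1)$; (c) the commutation $[\Delta^2\mathcal{R},P]=0$; (d) the $(\sigma,\kappa)$-reversibility $P_{z,w}=\dfrac{\kappa(z)}{\kappa(w)}\,P_{\sigma(z),\sigma(w)}$ for all $z,w\in\mathcal{T}$. Moreover, when these hold and the boundary fluxes satisfy the twisted pairing $b^{(1)}_z=\kappa(z)\,b^{(0)}_{\sigma(z)}$ for all $z\in\mathcal{T}$, the reset-neutral coupling takes the universal value $C^*=1/(1+\sqrt K)$.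
   Context: Setting. A Markov chain lives on a finite set $\mathcal{T}\cup\partial_0\cup\partial_1$ (disjoint union); $\mathcal{T}$ consists of transient states, $\partial_0\cup\partial_1$ is the absorbing boundary, the restriction of the chain to $\mathcal{T}$ is irreducible, and absorption is certain from every state of $\mathcal{T}$. $P=(P_{z,w})_{z,w\in\mathcal{T}}$ is the restricted transition matrix (spectral radius $<1$), and $R(\gamma)=(I-(1-\gamma)P)^{-1}$ for $\gamma\in(0,1)$ is its resolvent. The boundary fluxes are $b^{(0)}_x=\sum_{y\in\partial_0}P_{xy}$, $b^{(1)}_x=\sum_{y\in\partial_1}P_{xy}$, $b=b^{(0)}+b^{(1)}$ (vectors indexed by $\mathcal{T}$). $P$ has eigenvalues $\lambda_\nu$ (multiplicities allowed) and biorthogonal right/left eigenvectors $\varphi_\nu,\psi_\nu$: $P\varphi_\nu=\lambda_\nu\varphi_\nu$, $\psi_\nu^{\mathsf T}P=\lambda_\nu\psi_\nu^{\mathsf T}$, $\psi_\nu^{\mathsf T}\varphi_\mu=\delta_{\nu\mu}$. The spectral coefficients are $A_\nu(z)=\varphi_\nu(z)\,(\psi_\nu^{\mathsf T}b^{(0)})$ and $B_\nu(z)=\varphi_\nu(z)\,(\psi_\nu^{\mathsf T}b^{(1)})$. A mode $\nu$ is active if $\psi_\nu^{\mathsf T}b^{(0)}\neq0$ (i.e. $A_\nu\not\equiv0$) and inactive otherwise. Convention on inactive modes. The spectral duality is understood for every spectral mode; equivalently (in the source's wording), every statement asserting $[\Delta^2\mathcal{R},P]=0$ is to be read on the span of the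 active modes. Operators on functions $f$ on $\mathcal{T}$: $(\mathcal{R}f)(z)=f(\sigma(z))$ and $\Delta=\operatorname{diag}(\sqrt{\kappa(z)})$, so $(\Delta^2\mathcal{R}f)(z)=\kappa(z)f(\sigma(z))$. An involution satisfies $\sigma\circ\sigma=\mathrm{id}$ (fixed points allowed). $[X,Y]=XY-YX$. Coupling. For a probability distribution $\pi$ on $\mathcal{T}$ (the reset distribution), $C(\pi,\gamma)=\langle\pi,R(\gamma)b^{(0)}\rangle/\langle\pi,R(\gamma)b\rangle$, with $\langle\pi,v\rangle=\sum_z\pi_zv_z$. The reset-neutral coupling is the value $C(\pi^*,\gamma)$, $\gamma\in(0,1)$, at a reset-neutral distribution $\pi^*$: for any $z\in\mathcal{T}$, $\pi^*$ is the distribution on the pair $\{z,\sigma(z)\}$ with $\pi^*_z/\pi^*_{\sigma(z)}=\sqrt{\kappa(\sigma(z))}/\sqrt{\kappa(z)}$ (the point mass at $z$ if $\sigma(z)=z$).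
   Formalization: (b)-(d) imply (a) only under the twisted pairing and for eigenvectors adapted to Δ²R in repeated eigenspaces (such a choice exists), as the implication fails otherwise; (a) is linked to (b)-(d) on the span of the active modes, or to the literal forms if all modes are active. *)

theory Defs
  imports "HOL-Analysis.Analysis"
begin

section \<open>Absorbing chains\<close>

text \<open>The state space is the sum type \<open>'t + 'd\<close>: \<open>Inl\<close> embeds the transient set and \<open>Inr\<close> the
  boundary, which is partitioned into \<open>D0\<close> and \<open>D1\<close> (either of which may be empty).\<close>

definition matpow :: "real^'n^'n \<Rightarrow> nat \<Rightarrow> real^'n^'n" where
  "matpow A n = (((**) A) ^^ n) (mat 1)"

definition trans_part :: "real^('t::finite + 'd::finite)^('t + 'd) \<Rightarrow> real^'t^'t" where
  "trans_part Q = (\<chi> z w. Q $ Inl z $ Inl w)"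

text \<open>Boundary states are absorbing, so the \<open>n\<close>-step probability of being in the boundary is the
  probability of having been absorbed by time \<open>n\<close>; its limit is the absorption probability.\<close>

definition absorbing_chain ::
  "real^('t::finite + 'd::finite)^('t + 'd) \<Rightarrow> 'd set \<Rightarrow> 'd set \<Rightarrow> bool" where
  "absorbing_chain Q D0 D1 \<longleftrightarrow>
     D0 \<inter> D1 = {} \<and> D0 \<union> D1 = UNIV \<and>
     (\<forall>x y. 0 \<le> Q $ x $ y) \<and> (\<forall>x. (\<Sum>y\<in>UNIV. Q $ x $ y) = 1) \<and>
     (\<forall>y. Q $ Inr y $ Inr y = 1) \<and>
     (\<forall>z w. \<exists>n. 0 < matpow (trans_part Q) n $ z $ w) \<and>
     (\<forall>z. (\<lambda>n. \<Sum>y\<in>UNIV. matpow Q n $ Inl z $ Inr y) \<longlonglongrightarrow> 1)"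

definition bflux :: "real^('t::finite + 'd::finite)^('t + 'd) \<Rightarrow> 'd set \<Rightarrow> real^'t" where
  "bflux Q D = (\<chi> x. \<Sum>y\<in>D. Q $ Inl x $ Inr y)"

definition resolvent :: "real^'t^'t \<Rightarrow> real \<Rightarrow> real^'t^'t" where
  "resolvent P \<gamma> = matrix_inv (mat 1 - (1 - \<gamma>) *\<^sub>R P)"


section \<open>The operators \<open>\<R>\<close>, \<open>\<Delta>\<close> and the matrix conditions\<close>

definition Refl :: "('t::finite \<Rightarrow> 't) \<Rightarrow> real^'t^'t" where
  "Refl \<sigma> = (\<chi> z w. if w = \<sigma> z then 1 else 0)"

definition Delta :: "('t::finite \<Rightarrow> real) \<Rightarrow> real^'t^'t" where
  "Delta \<kappa> = (\<chi> z w. if z = w then sqrt (\<kappa> z) else 0)"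

definition Delta2Refl :: "('t::finite \<Rightarrow> 't) \<Rightarrow> ('t \<Rightarrow> real) \<Rightarrow> real^'t^'t" where
  "Delta2Refl \<sigma> \<kappa> = Delta \<kappa> ** Delta \<kappa> ** Refl \<sigma>"

definition commutator :: "real^'t^'t \<Rightarrow> real^'t^'t \<Rightarrow> real^'t^'t" where
  "commutator X Y = X ** Y - Y ** X"

definition resolvent_symmetry :: "('t::finite \<Rightarrow> 't) \<Rightarrow> ('t \<Rightarrow> real) \<Rightarrow> real^'t^'t \<Rightarrow> bool" where
  "resolvent_symmetry \<sigma> \<kappa> P \<longleftrightarrow>
     (\<forall>\<gamma>\<in>{0<..<1}. Refl \<sigma> ** resolvent P \<gamma> ** Refl \<sigma>
        = matrix_inv (Delta \<kappa> ** Delta \<kappa>) ** resolvent P \<gamma> ** (Delta \<kappa> ** Delta \<kappa>))"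

text \<open>The matrix whose entries form the right-hand side of \<open>(\<sigma>,\<kappa>)\<close>-reversibility.\<close>

definition reversed :: "('t::finite \<Rightarrow> 't) \<Rightarrow> ('t \<Rightarrow> real) \<Rightarrow> real^'t^'t \<Rightarrow> real^'t^'t" where
  "reversed \<sigma> \<kappa> P = (\<chi> z w. \<kappa> z / \<kappa> w * P $ \<sigma> z $ \<sigma> w)"

definition sk_reversible :: "('t::finite \<Rightarrow> 't) \<Rightarrow> ('t \<Rightarrow> real) \<Rightarrow> real^'t^'t \<Rightarrow> bool" where
  "sk_reversible \<sigma> \<kappa> P \<longleftrightarrow> (\<forall>z w. P $ z $ w = reversed \<sigma> \<kappa> P $ z $ w)"

definition twisted_pairing :: "('t::finite \<Rightarrow> 't) \<Rightarrow> ('t \<Rightarrow> real) \<Rightarrow> real^'t \<Rightarrow> real^'t \<Rightarrow> bool" where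
  "twisted_pairing \<sigma> \<kappa> b0 b1 \<longleftrightarrow> (\<forall>z. b1 $ z = \<kappa> z * b0 $ \<sigma> z)"


section \<open>Spectral modes\<close>

text \<open>A real matrix may have complex eigenvalues, so the spectral theory is over the complex
  numbers. The pairing \<open>u\<^sup>T v\<close> is bilinear: no conjugation.\<close>

definition cmat :: "real^'n^'m \<Rightarrow> complex^'n^'m" where
  "cmat A = map_matrix of_real A"

definition cvec :: "real^'n \<Rightarrow> complex^'n" where
  "cvec v = (\<chi> i. of_real (v $ i))"

definition bil :: "complex^'n \<Rightarrow> complex^'n \<Rightarrow> complex" where
  "bil u v = (\<Sum>i\<in>UNIV. u $ i * v $ i)"

definition diagonalizable :: "complex^'n^'n \<Rightarrow> bool" where
  "diagonalizable A \<longleftrightarrow>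
     (\<exists>S D :: complex^'n^'n. invertible S \<and> (\<forall>i j. i \<noteq> j \<longrightarrow> D $ i $ j = 0) \<and> A = S ** D ** matrix_inv S)"

text \<open>A complete biorthogonal system has as many modes as there are transient states; the
  modes are labelled by \<open>'t\<close> itself. Eigenvalues may repeat.\<close>

definition eigensystem ::
  "real^'t^'t \<Rightarrow> ('t::finite \<Rightarrow> complex) \<Rightarrow> ('t \<Rightarrow> complex^'t) \<Rightarrow> ('t \<Rightarrow> complex^'t) \<Rightarrow> bool" where
  "eigensystem P lam \<phi> \<psi> \<longleftrightarrow>
     (\<forall>\<nu>. cmat P *v \<phi> \<nu> = lam \<nu> *s \<phi> \<nu>) \<and>
     (\<forall>\<nu>. \<psi> \<nu> v* cmat P = lam \<nu> *s \<psi> \<nu>) \<and>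
     (\<forall>\<nu> \<mu>. bil (\<psi> \<nu>) (\<phi> \<mu>) = (if \<nu> = \<mu> then 1 else 0))"

text \<open>\<open>A\<^sub>\<nu>(z)\<close> is \<open>spec_coeff\<close> for the flux into \<open>D0\<close>, and \<open>B\<^sub>\<nu>(z)\<close> for the flux into \<open>D1\<close>.\<close>

definition spec_coeff ::
  "('t::finite \<Rightarrow> complex^'t) \<Rightarrow> ('t \<Rightarrow> complex^'t) \<Rightarrow> real^'t \<Rightarrow> 't \<Rightarrow> 't \<Rightarrow> complex" where
  "spec_coeff \<phi> \<psi> b \<nu> z = \<phi> \<nu> $ z * bil (\<psi> \<nu>) (cvec b)"

definition spectral_duality ::
  "('t::finite \<Rightarrow> 't) \<Rightarrow> ('t \<Rightarrow> real) \<Rightarrow> ('t \<Rightarrow> complex^'t) \<Rightarrow> ('t \<Rightarrow> complex^'t) \<Rightarrow>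
     real^'t \<Rightarrow> real^'t \<Rightarrow> bool" where
  "spectral_duality \<sigma> \<kappa> \<phi> \<psi> b0 b1 \<longleftrightarrow>
     (\<forall>\<nu> z. spec_coeff \<phi> \<psi> b1 \<nu> z = of_real (\<kappa> z) * spec_coeff \<phi> \<psi> b0 \<nu> (\<sigma> z))"

definition active :: "('t::finite \<Rightarrow> complex^'t) \<Rightarrow> real^'t \<Rightarrow> 't \<Rightarrow> bool" where
  "active \<psi> b0 \<nu> \<longleftrightarrow> bil (\<psi> \<nu>) (cvec b0) \<noteq> 0"

text \<open>\<open>vec.span\<close> is the complex span (\<open>span\<close> would be the real one).\<close>

definition active_span ::
  "('t::finite \<Rightarrow> complex^'t) \<Rightarrow> ('t \<Rightarrow> complex^'t) \<Rightarrow> real^'t \<Rightarrow> (complex^'t) set" where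
  "active_span \<phi> \<psi> b0 = vec.span (\<phi> ` {\<nu>. active \<psi> b0 \<nu>})"

text \<open>A matrix identity read on a set \<open>V\<close> of functions.\<close>

definition eq_on :: "(complex^'t) set \<Rightarrow> real^'t^'t \<Rightarrow> real^'t^'t \<Rightarrow> bool" where
  "eq_on V X Y \<longleftrightarrow> (\<forall>f\<in>V. cmat X *v f = cmat Y *v f)"

text \<open>When an eigenvalue is repeated, its eigenvectors are not determined up to scaling, and for
  a generic choice the spectral duality fails even if \<open>\<Delta>\<^sup>2\<R>\<close> commutes with \<open>P\<close>. The choice is adapted
  to \<open>\<Delta>\<^sup>2\<R>\<close> if a mode that \<open>\<Delta>\<^sup>2\<R>\<close> maps into its own eigenspace is an eigenvector of \<open>\<Delta>\<^sup>2\<R>\<close>. For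
  simple eigenvalues this is automatic.\<close>

definition adapted ::
  "('t::finite \<Rightarrow> 't) \<Rightarrow> ('t \<Rightarrow> real) \<Rightarrow> real^'t^'t \<Rightarrow> ('t \<Rightarrow> complex) \<Rightarrow> ('t \<Rightarrow> complex^'t) \<Rightarrow> bool" where
  "adapted \<sigma> \<kappa> P lam \<phi> \<longleftrightarrow>
     (\<forall>\<nu>. let g = cmat (Delta2Refl \<sigma> \<kappa>) *v \<phi> \<nu> in
        cmat P *v g = lam \<nu> *s g \<longrightarrow> (\<exists>c. g = c *s \<phi> \<nu>))"


section \<open>Reset-neutral coupling\<close>

definition coupling :: "real^'t^'t \<Rightarrow> real^'t \<Rightarrow> real^'t \<Rightarrow> real^'t \<Rightarrow> real \<Rightarrow> real" where
  "coupling P b0 b1 \<pi> \<gamma> =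
     (\<pi> \<bullet> (resolvent P \<gamma> *v b0)) / (\<pi> \<bullet> (resolvent P \<gamma> *v (b0 + b1)))"

text \<open>If \<open>\<sigma> z = z\<close> this forces the point mass at \<open>z\<close>. If \<open>\<sigma> z \<noteq> z\<close> and \<open>\<kappa>\<close> is positive, the ratio
  condition excludes \<open>\<pi> $ \<sigma> z = 0\<close>, since division by zero gives zero.\<close>

definition reset_neutral :: "('t::finite \<Rightarrow> 't) \<Rightarrow> ('t \<Rightarrow> real) \<Rightarrow> 't \<Rightarrow> real^'t \<Rightarrow> bool" where
  "reset_neutral \<sigma> \<kappa> z \<pi> \<longleftrightarrow>
     (\<forall>w. 0 \<le> \<pi> $ w) \<and> (\<Sum>w\<in>UNIV. \<pi> $ w) = 1 \<and> (\<forall>w. w \<notin> {z, \<sigma> z} \<longrightarrow> \<pi> $ w = 0) \<and>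
     \<pi> $ z / \<pi> $ \<sigma> z = sqrt (\<kappa> (\<sigma> z)) / sqrt (\<kappa> z)"

definition universal_coupling ::
  "('t::finite \<Rightarrow> 't) \<Rightarrow> ('t \<Rightarrow> real) \<Rightarrow> real \<Rightarrow> real^'t^'t \<Rightarrow> real^'t \<Rightarrow> real^'t \<Rightarrow> bool" where
  "universal_coupling \<sigma> \<kappa> K P b0 b1 \<longleftrightarrow>
     (\<forall>z \<pi>. \<forall>\<gamma>\<in>{0<..<1}. reset_neutral \<sigma> \<kappa> z \<pi> \<longrightarrow>
        coupling P b0 b1 \<pi> \<gamma> = 1 / (1 + sqrt K))"

end

theory Submission
  imports Defs
begin

text \<open>
  Write \<open>M = \<Delta>\<^sup>2\<R>\<close>, so \<open>(M f)(z) = \<kappa>(z) f(\<sigma>(z))\<close>. Since \<open>\<sigma>\<close> is an involution and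
  \<open>\<kappa>(z) \<kappa>(\<sigma>(z)) = K\<close>, the square of \<open>M\<close> is the positive scalar \<open>K\<close>.

  \<^bold>\<open>Matrix conditions.\<close> The resolvent is the inverse of \<open>I - (1 - \<gamma>) P\<close>, and a matrix commutes with
  an invertible matrix iff it commutes with the inverse, so commuting with one resolvent, with all
  resolvents, and with \<open>P\<close> are the same. Invertibility comes from a minimum principle for
  substochastic matrices. Reversibility says \<open>P = M P M\<^sup>-\<^sup>1\<close>, because \<open>M\<^sup>-\<^sup>1 = M / K\<close>. On the span of
  the active modes the same arguments work mode by mode: on an eigenvector, commuting with \<open>P\<close> or
  with the resolvent both mean that \<open>M\<close> maps it into its own eigenspace
  (\<open>commute_inverse_on_eigenvector_iff\<close>).

  \<^bold>\<open>Duality.\<close> For a mode \<open>\<nu>\<close> the duality is the vector identity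
  \<open>(\<psi>\<^sub>\<nu>\<^sup>T b1) \<phi>\<^sub>\<nu> = (\<psi>\<^sub>\<nu>\<^sup>T b0) M \<phi>\<^sub>\<nu>\<close>. Its sum over all modes is the twisted pairing
  \<open>b1 = M b0\<close>, and for an active mode it makes \<open>M \<phi>\<^sub>\<nu>\<close> a multiple of \<open>\<phi>\<^sub>\<nu>\<close>, which gives the
  commutation there. Conversely, commutation puts \<open>M \<phi>\<^sub>\<nu>\<close> in the eigenspace of \<open>\<phi>\<^sub>\<nu>\<close>, adaptedness
  turns this into \<open>M \<phi>\<^sub>\<nu> = c\<^sub>\<nu> \<phi>\<^sub>\<nu>\<close>, and the duality follows by comparing coefficients in
  \<open>b1 = M b0\<close>. Adapted systems exist because \<open>M\<^sup>2 = K\<close> makes \<open>M\<close> diagonalizable on the part of each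
  eigenspace that it maps back into the eigenspace (\<open>adapted_eigensystem_exists\<close>).

  \<^bold>\<open>Coupling.\<close> A reset-neutral \<open>\<pi>\<close> is a left eigenvector of \<open>M\<close> with eigenvalue \<open>\<surd>K\<close>
  (\<open>reset_neutral_inner\<close>). With \<open>u = R(\<gamma>) b0\<close> the commutation gives \<open>R(\<gamma>) b1 = M u\<close>, so the
  coupling is \<open>\<langle>\<pi>, u\<rangle> / ((1 + \<surd>K) \<langle>\<pi>, u\<rangle>)\<close>. The cancellation needs \<open>\<langle>\<pi>, u\<rangle> \<noteq> 0\<close>, which holds since
  certain absorption and the pairing force \<open>b0 \<noteq> 0\<close> and irreducibility then makes \<open>u\<close> strictly positive
  (\<open>resolvent_pos\<close>).
\<close>

section \<open>Real and complex matrices\<close>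

lemma matrix_inv_eqI:
  fixes A B :: "'a::field^'n^'n"
  assumes "A ** B = mat 1"
  shows "matrix_inv A = B"
proof -
  have "\<exists>A'. A ** A' = mat 1 \<and> A' ** A = mat 1"
    using assms matrix_left_right_inverse by blast
  then have "A ** matrix_inv A = mat 1 \<and> matrix_inv A ** A = mat 1"
    unfolding matrix_inv_def by (rule someI_ex)
  then show ?thesis
    by (metis assms matrix_mul_assoc matrix_mul_lid matrix_mul_rid)
qed

lemma cmat_mult: "cmat (A ** B) = cmat A ** cmat B"
  by (simp add: cmat_def matrix_matrix_mult_def vec_eq_iff)

lemma cmat_diff: "cmat (A - B) = cmat A - cmat B"
  by (simp add: cmat_def vec_eq_iff)

lemma cmat_0: "cmat 0 = 0"
  by (simp add: cmat_def vec_eq_iff)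

lemma cmat_1: "cmat (mat 1) = mat 1"
  by (simp add: cmat_def vec_eq_iff mat_def)

lemma cmat_scaleR_mult_vec: "cmat (c *\<^sub>R A) *v f = of_real c *s (cmat A *v f)"
  by (simp add: cmat_def vec_eq_iff matrix_vector_mult_def sum_distrib_left mult.assoc)

lemma cmat_inject: "cmat A = cmat B \<longleftrightarrow> A = B"
  by (simp add: cmat_def vec_eq_iff)

lemma cmat_mult_cvec: "cmat A *v cvec v = cvec (A *v v)"
  by (simp add: cmat_def cvec_def vec_eq_iff matrix_vector_mult_def)

lemma cvec_inject: "cvec v = cvec w \<longleftrightarrow> v = w"
  by (simp add: cvec_def vec_eq_iff)

lemma commutator_eq_0_iff: "commutator X Y = 0 \<longleftrightarrow> X ** Y = Y ** X"
  by (simp add: commutator_def)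

lemma cmat_commutator_eq_0_iff:
  "cmat (commutator X Y) *v f = cmat 0 *v f \<longleftrightarrow>
     cmat X *v (cmat Y *v f) = cmat Y *v (cmat X *v f)"
  by (simp add: commutator_def cmat_diff cmat_0 cmat_mult matrix_vector_mult_diff_rdistrib
      matrix_vector_mul_assoc)

lemma commute_inverse_iff:
  fixes A G M :: "'a::field^'n^'n"
  assumes "A ** G = mat 1"
  shows "M ** G = G ** M \<longleftrightarrow> M ** A = A ** M"
proof -
  have GA: "G ** A = mat 1"
    using assms matrix_left_right_inverse by blast
  show ?thesis
  proof
    assume eq: "M ** G = G ** M"
    have "M ** A = A ** (G ** M) ** A"
      by (metis assms matrix_mul_assoc matrix_mul_lid)
    also have "\<dots> = A ** M"
      by (metis eq GA matrix_mul_assoc matrix_mul_rid)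
    finally show "M ** A = A ** M" .
  next
    assume eq: "M ** A = A ** M"
    have "M ** G = G ** (A ** M) ** G"
      by (metis GA matrix_mul_assoc matrix_mul_lid)
    also have "\<dots> = G ** M"
      by (metis eq assms matrix_mul_assoc matrix_mul_rid)
    finally show "M ** G = G ** M" .
  qed
qed

text \<open>Commuting with \<open>A\<close> on a single vector does not in general imply commuting with \<open>A\<^sup>-\<^sup>1\<close> on it;
  on an eigenvector \<open>A\<close> and \<open>A\<^sup>-\<^sup>1\<close> act as reciprocal scalars, so both conditions say that \<open>M f\<close> is
  in the same eigenspace as \<open>f\<close>.\<close>

lemma commute_inverse_on_eigenvector_iff:
  fixes A G M :: "'a::field^'n^'n"
  assumes AG: "A ** G = mat 1" and f: "A *v f = \<alpha> *s f"
  shows "M *v (G *v f) = G *v (M *v f) \<longleftrightarrow> M *v (A *v f) = A *v (M *v f)"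
proof (cases "f = 0")
  case False
  have AGv: "A *v (G *v x) = x" and GAv: "G *v (A *v x) = x" for x
    using AG matrix_left_right_inverse[of A G]
    by (simp_all add: matrix_vector_mul_assoc)
  have \<alpha>: "\<alpha> \<noteq> 0"
    using False GAv[of f] by (auto simp: f)
  have "f = \<alpha> *s (G *v f)"
    using GAv[of f] by (simp add: f vector_scalar_commute)
  then have Gf: "G *v f = inverse \<alpha> *s f"
    by (metis \<alpha> left_inverse vector_smult_assoc vector_smult_lid)
  have "inverse \<alpha> *s (M *v f) = G *v (M *v f) \<longleftrightarrow> \<alpha> *s (M *v f) = A *v (M *v f)"
  proof
    assume "inverse \<alpha> *s (M *v f) = G *v (M *v f)"
    then have "M *v f = inverse \<alpha> *s (A *v (M *v f))"
      by (metis AGv vector_scalar_commute)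
    then show "\<alpha> *s (M *v f) = A *v (M *v f)"
      by (metis \<alpha> right_inverse vector_smult_assoc vector_smult_lid)
  next
    assume "\<alpha> *s (M *v f) = A *v (M *v f)"
    then have "M *v f = \<alpha> *s (G *v (M *v f))"
      by (metis GAv vector_scalar_commute)
    then show "inverse \<alpha> *s (M *v f) = G *v (M *v f)"
      by (metis \<alpha> left_inverse vector_smult_assoc vector_smult_lid)
  qed
  then show ?thesis
    by (simp add: Gf f vector_scalar_commute)
qed simp

lemma eq_on_span_iff:
  "eq_on (vec.span S) X Y \<longleftrightarrow> (\<forall>f\<in>S. cmat X *v f = cmat Y *v f)"
proof
  assume *: "\<forall>f\<in>S. cmat X *v f = cmat Y *v f"
  have "vec.subspace {f. cmat X *v f = cmat Y *v f}"
    by (auto simp: vec.subspace_def matrix_vector_right_distrib vector_scalar_commute)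
  then have "vec.span S \<subseteq> {f. cmat X *v f = cmat Y *v f}"
    using * by (intro vec.span_minimal) auto
  then show "eq_on (vec.span S) X Y"
    by (auto simp: eq_on_def)
qed (auto simp: eq_on_def vec.span_base)

lemma eq_on_UNIV_iff: "eq_on UNIV X Y \<longleftrightarrow> X = Y"
  by (metis UNIV_I cmat_inject eq_on_def matrix_eq)


section \<open>Resolvents of substochastic matrices\<close>

definition substochastic :: "real^'t^'t \<Rightarrow> bool" where
  "substochastic P \<longleftrightarrow> (\<forall>z w. 0 \<le> P $ z $ w) \<and> (\<forall>z. (\<Sum>w\<in>UNIV. P $ z $ w) \<le> 1)"

definition irreducible_matrix :: "real^'t^'t \<Rightarrow> bool" where
  "irreducible_matrix P \<longleftrightarrow> (\<forall>z w. \<exists>n. 0 < matpow P n $ z $ w)"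

text \<open>The minimum principle: at a minimum with negative value, \<open>c P u\<close> would exceed \<open>u\<close>.\<close>

lemma substochastic_minimum_principle:
  fixes P :: "real^'t^'t"
  assumes P: "substochastic P" and c: "0 \<le> c" "c < 1"
    and u: "\<And>z. c * (P *v u) $ z \<le> u $ z"
  shows "0 \<le> u $ z"
proof -
  define m where "m = arg_min_on (\<lambda>z. u $ z) UNIV"
  have m: "u $ m \<le> u $ w" for w
    unfolding m_def by (rule arg_min_least) auto
  have "0 \<le> u $ m"
  proof (rule ccontr)
    assume neg: "\<not> 0 \<le> u $ m"
    have "u $ m * 1 \<le> u $ m * (\<Sum>w\<in>UNIV. P $ m $ w)"
      using P neg by (intro mult_left_mono_neg) (auto simp: substochastic_def)
    also have "\<dots> = (\<Sum>w\<in>UNIV. P $ m $ w * u $ m)"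
      by (simp add: sum_distrib_left mult.commute)
    also have "\<dots> \<le> (P *v u) $ m"
      unfolding matrix_vector_mult_def
      using P m by (auto simp: substochastic_def intro!: sum_mono mult_left_mono)
    finally have "c * u $ m \<le> c * (P *v u) $ m"
      using c by (simp add: mult_left_mono)
    also have "\<dots> \<le> u $ m" by (rule u)
    finally have "0 \<le> (1 - c) * u $ m" by (simp add: algebra_simps)
    then show False
      using neg c by (simp add: zero_le_mult_iff)
  qed
  then show ?thesis using m[of z] by linarith
qed

lemma id_minus_scaleR_mult_vec:
  "(mat 1 - c *\<^sub>R P) *v u = u - c *\<^sub>R (P *v u)" for P :: "real^'t^'t"
  by (simp add: matrix_vector_mult_diff_rdistrib scaleR_matrix_vector_assoc)

lemma resolvent_right_inverse:
  fixes P :: "real^'t^'t"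
  assumes P: "substochastic P" and \<gamma>: "\<gamma> \<in> {0<..<1}"
  shows "(mat 1 - (1 - \<gamma>) *\<^sub>R P) ** resolvent P \<gamma> = mat 1"
proof -
  have "v = 0" if "(mat 1 - (1 - \<gamma>) *\<^sub>R P) *v v = 0" for v
  proof -
    have v: "v = (1 - \<gamma>) *\<^sub>R (P *v v)"
      using that by (simp add: id_minus_scaleR_mult_vec)
    then have vz: "v $ z = (1 - \<gamma>) * (P *v v) $ z" for z
      by (metis real_scaleR_def vector_scaleR_component)
    have "0 \<le> v $ z" for z
      using vz \<gamma> by (intro substochastic_minimum_principle[OF P, of "1 - \<gamma>"]) auto
    moreover have "0 \<le> (- v) $ z" for z
    proof (intro substochastic_minimum_principle[OF P, of "1 - \<gamma>"])
      show "(1 - \<gamma>) * (P *v - v) $ x \<le> (- v) $ x" for x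
        using vz[of x] matrix_vector_mult_diff_distrib[of P 0 v] by simp
    qed (use \<gamma> in auto)
    ultimately show "v = 0"
      by (simp add: vec_eq_iff order_antisym)
  qed
  then have "\<exists>B. B ** (mat 1 - (1 - \<gamma>) *\<^sub>R P) = mat 1"
    unfolding matrix_left_invertible_ker by blast
  then obtain B where "(mat 1 - (1 - \<gamma>) *\<^sub>R P) ** B = mat 1"
    using matrix_left_right_inverse by blast
  then show ?thesis
    by (simp add: resolvent_def matrix_inv_eqI)
qed

lemma commute_resolvent_iff:
  fixes P :: "real^'t^'t"
  assumes P: "substochastic P" and \<gamma>: "\<gamma> \<in> {0<..<1}"
  shows "commutator M (resolvent P \<gamma>) = 0 \<longleftrightarrow> commutator M P = 0"
proof -
  have "M ** (mat 1 - (1 - \<gamma>) *\<^sub>R P) = M - (1 - \<gamma>) *\<^sub>R (M ** P)"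
    by (simp add: matrix_eq matrix_vector_mult_diff_distrib matrix_vector_mult_diff_rdistrib
        matrix_vector_mult_scaleR flip: matrix_vector_mul_assoc scaleR_matrix_vector_assoc)
  moreover have "(mat 1 - (1 - \<gamma>) *\<^sub>R P) ** M = M - (1 - \<gamma>) *\<^sub>R (P ** M)"
    by (simp add: matrix_eq matrix_vector_mult_diff_rdistrib
        flip: matrix_vector_mul_assoc scaleR_matrix_vector_assoc)
  ultimately have "M ** (mat 1 - (1 - \<gamma>) *\<^sub>R P) = (mat 1 - (1 - \<gamma>) *\<^sub>R P) ** M \<longleftrightarrow> M ** P = P ** M"
    using \<gamma> by simp
  then show ?thesis
    using commute_inverse_iff[OF resolvent_right_inverse[OF P \<gamma>], of M]
    by (simp add: commutator_eq_0_iff)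
qed

lemma commute_resolvent_on_eigenvector_iff:
  fixes P :: "real^'t^'t"
  assumes P: "substochastic P" and \<gamma>: "\<gamma> \<in> {0<..<1}" and f: "cmat P *v f = l *s f"
  shows "cmat (commutator M (resolvent P \<gamma>)) *v f = cmat 0 *v f \<longleftrightarrow>
         cmat (commutator M P) *v f = cmat 0 *v f"
proof -
  define A where "A = mat 1 - (1 - \<gamma>) *\<^sub>R P"
  have A: "cmat A *v g = g - of_real (1 - \<gamma>) *s (cmat P *v g)" for g
    unfolding A_def cmat_diff cmat_1 matrix_vector_mult_diff_rdistrib cmat_scaleR_mult_vec by simp
  have "cmat A ** cmat (resolvent P \<gamma>) = mat 1"
    using resolvent_right_inverse[OF P \<gamma>] by (simp add: A_def cmat_1 flip: cmat_mult)
  moreover have "cmat A *v f = (1 - of_real (1 - \<gamma>) * l) *s f"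
    by (simp add: A f vec_eq_iff algebra_simps)
  ultimately have "cmat M *v (cmat (resolvent P \<gamma>) *v f) = cmat (resolvent P \<gamma>) *v (cmat M *v f)
      \<longleftrightarrow> cmat M *v (cmat A *v f) = cmat A *v (cmat M *v f)"
    by (rule commute_inverse_on_eigenvector_iff)
  also have "\<dots> \<longleftrightarrow> of_real (1 - \<gamma>) *s (cmat M *v (cmat P *v f))
      = of_real (1 - \<gamma>) *s (cmat P *v (cmat M *v f))"
    unfolding A matrix_vector_mult_diff_distrib vector_scalar_commute
    by (simp del: of_real_diff)
  also have "\<dots> \<longleftrightarrow> cmat M *v (cmat P *v f) = cmat P *v (cmat M *v f)"
    using \<gamma> by (simp del: of_real_diff)
  finally show ?thesis
    unfolding cmat_commutator_eq_0_iff .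
qed

text \<open>The probabilistic content is that the chain reaches a state with positive source before
  the geometric reset time with positive probability. Analytically, \<open>u = R(\<gamma>) b\<close> solves
  \<open>u = b + (1 - \<gamma>) P u\<close>, hence is nonnegative and dominates \<open>(1 - \<gamma>)\<^sup>n P\<^sup>n u\<close> for every \<open>n\<close>.\<close>

lemma resolvent_pos:
  fixes P :: "real^'t^'t"
  assumes P: "substochastic P" and irr: "irreducible_matrix P" and \<gamma>: "\<gamma> \<in> {0<..<1}"
    and b: "\<And>z. 0 \<le> b $ z" "b \<noteq> 0"
  shows "0 < (resolvent P \<gamma> *v b) $ z"
proof -
  define u where "u = resolvent P \<gamma> *v b"
  have "(mat 1 - (1 - \<gamma>) *\<^sub>R P) *v u = b"
    by (simp add: u_def matrix_vector_mul_assoc resolvent_right_inverse[OF P \<gamma>])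
  then have u: "u = b + (1 - \<gamma>) *\<^sub>R (P *v u)"
    by (simp add: id_minus_scaleR_mult_vec diff_eq_eq)
  have uz: "u $ x = b $ x + (1 - \<gamma>) * (P *v u) $ x" for x
    by (subst u) simp
  have P0: "0 \<le> P $ x $ y" for x y
    using P by (simp add: substochastic_def)
  have u0: "0 \<le> u $ x" for x
  proof (rule substochastic_minimum_principle[OF P])
    show "(1 - \<gamma>) * (P *v u) $ y \<le> u $ y" for y
      using uz[of y] b(1)[of y] by linarith
  qed (use \<gamma> in auto)
  have bu: "b $ x \<le> u $ x" for x
  proof -
    have "0 \<le> (P *v u) $ x"
      unfolding matrix_vector_mult_def using P0 u0 by (simp add: sum_nonneg)
    then show ?thesis
      using uz[of x] \<gamma> by simp
  qed
  have dom: "(1 - \<gamma>) ^ n * (matpow P n *v u) $ x \<le> u $ x" for n x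
  proof (induction n arbitrary: x)
    case 0
    show ?case by (simp add: matpow_def)
  next
    case (Suc n)
    have "matpow P (Suc n) *v u = P *v (matpow P n *v u)"
      by (simp add: matpow_def matrix_vector_mul_assoc)
    then have "(1 - \<gamma>) ^ Suc n * (matpow P (Suc n) *v u) $ x
        = (1 - \<gamma>) * (\<Sum>w\<in>UNIV. P $ x $ w * ((1 - \<gamma>) ^ n * (matpow P n *v u) $ w))"
      by (simp add: matrix_vector_mult_def[of P] sum_distrib_left mult_ac)
    also have "\<dots> \<le> (1 - \<gamma>) * (\<Sum>w\<in>UNIV. P $ x $ w * u $ w)"
      using Suc P0 \<gamma> by (intro mult_left_mono sum_mono) auto
    also have "\<dots> \<le> u $ x"
      using uz[of x] b(1)[of x] by (simp add: matrix_vector_mult_def)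
    finally show ?case .
  qed
  obtain w where "b $ w \<noteq> 0"
    using b(2) by (auto simp: vec_eq_iff)
  then have uw: "0 < u $ w"
    using b(1)[of w] bu[of w] by linarith
  obtain n where n: "0 < matpow P n $ z $ w"
    using irr by (auto simp: irreducible_matrix_def)
  have pow0: "0 \<le> matpow P n $ x $ y" for n x y
    by (induction n arbitrary: x)
       (auto simp: matpow_def mat_def matrix_matrix_mult_def P0 intro!: sum_nonneg)
  have "0 < matpow P n $ z $ w * u $ w"
    using n uw by simp
  also have "\<dots> \<le> (matpow P n *v u) $ z"
    unfolding matrix_vector_mult_def
    using member_le_sum[of w UNIV "\<lambda>y. matpow P n $ z $ y * u $ y"] pow0 u0 by simp
  finally have "0 < (1 - \<gamma>) ^ n * (matpow P n *v u) $ z"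
    using \<gamma> by simp
  also have "\<dots> \<le> u $ z" by (rule dom)
  finally show ?thesis by (simp add: u_def)
qed


section \<open>Absorbing chains\<close>

lemma sum_UNIV_Plus:
  "(\<Sum>x\<in>(UNIV :: ('a::finite + 'b::finite) set). f x)
     = (\<Sum>a\<in>UNIV. f (Inl a)) + (\<Sum>b\<in>UNIV. f (Inr b))"
  by (simp add: sum.Plus flip: UNIV_Plus_UNIV)

lemma substochastic_trans_part:
  assumes "absorbing_chain Q D0 D1"
  shows "substochastic (trans_part Q)"
proof -
  have Q0: "0 \<le> Q $ x $ y" and Q1: "(\<Sum>y\<in>UNIV. Q $ x $ y) = 1" for x y
    using assms by (auto simp: absorbing_chain_def)
  have "(\<Sum>w\<in>UNIV. Q $ Inl z $ Inl w) \<le> 1" for z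
    using Q1[of "Inl z"] sum_nonneg[of UNIV "\<lambda>y. Q $ Inl z $ Inr y"] Q0
    by (simp add: sum_UNIV_Plus)
  then show ?thesis
    by (simp add: substochastic_def trans_part_def Q0)
qed

lemma irreducible_trans_part:
  "absorbing_chain Q D0 D1 \<Longrightarrow> irreducible_matrix (trans_part Q)"
  by (simp add: irreducible_matrix_def absorbing_chain_def)

lemma bflux_nonneg: "absorbing_chain Q D0 D1 \<Longrightarrow> 0 \<le> bflux Q D $ z"
  by (auto simp: bflux_def absorbing_chain_def intro: sum_nonneg)

text \<open>Without flux into the boundary the chain would never be absorbed.\<close>

lemma bflux_nonzero:
  fixes Q :: "real^('t::finite + 'd::finite)^('t + 'd)"
  assumes chain: "absorbing_chain Q D0 D1"
  shows "bflux Q D0 \<noteq> 0 \<or> bflux Q D1 \<noteq> 0"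
proof (rule ccontr)
  assume "\<not> ?thesis"
  then have b: "bflux Q D0 = 0" "bflux Q D1 = 0" by auto
  have Q0: "0 \<le> Q $ x $ y" for x y
    using chain by (auto simp: absorbing_chain_def)
  have "Q $ Inl z $ Inr y = 0" if "y \<in> D" "bflux Q D = 0" for z y D
  proof -
    have "(\<Sum>y\<in>D. Q $ Inl z $ Inr y) = 0"
      using that(2) by (simp add: bflux_def vec_eq_iff)
    then show ?thesis
      using that(1) Q0 by (simp add: sum_nonneg_eq_0_iff)
  qed
  moreover have "y \<in> D0 \<or> y \<in> D1" for y
    using chain by (auto simp: absorbing_chain_def)
  ultimately have Q: "Q $ Inl z $ Inr y = 0" for z y
    using b by metis
  have "matpow Q n $ Inl z $ Inr y = 0" for n z y
  proof (induction n arbitrary: z)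
    case 0
    show ?case by (simp add: matpow_def mat_def)
  next
    case (Suc n)
    have "matpow Q (Suc n) = Q ** matpow Q n"
      by (simp add: matpow_def)
    then show ?case
      by (simp add: matrix_matrix_mult_def sum_UNIV_Plus Suc Q)
  qed
  moreover have "(\<lambda>n. \<Sum>y\<in>UNIV. matpow Q n $ Inl z $ Inr y) \<longlonglongrightarrow> 1" for z
    using chain by (simp add: absorbing_chain_def)
  ultimately have "(\<lambda>n. 0 :: real) \<longlonglongrightarrow> 1"
    by simp
  then show False
    by (simp add: LIMSEQ_const_iff)
qed


section \<open>Biorthogonal eigensystems\<close>

lemma bil_sum_right: "bil u (\<Sum>\<nu>\<in>N. f \<nu>) = (\<Sum>\<nu>\<in>N. bil u (f \<nu>))"
  by (simp add: bil_def sum_distrib_left sum.swap[of _ N])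

lemma bil_scale_right: "bil u (c *s v) = c * bil u v"
  by (simp add: bil_def sum_distrib_left mult_ac)

text \<open>A one-sided inverse of a square matrix is two-sided: biorthogonality of as many modes as
  there are states is the completeness relation.\<close>

lemma eigensystem_expansion:
  fixes P :: "real^'t^'t"
  assumes "eigensystem P lam \<phi> \<psi>"
  shows "(\<Sum>\<nu>\<in>UNIV. bil (\<psi> \<nu>) v *s \<phi> \<nu>) = v"
proof -
  define \<Phi> where "\<Phi> = (\<chi> i \<nu>. \<phi> \<nu> $ i)"
  define \<Psi> where "\<Psi> = (\<chi> \<nu> i. \<psi> \<nu> $ i)"
  have "\<Psi> ** \<Phi> = mat 1"
    using assms
    by (simp add: eigensystem_def bil_def \<Phi>_def \<Psi>_def matrix_matrix_mult_def mat_def vec_eq_iff)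
  then have "\<Phi> ** \<Psi> = mat 1"
    using matrix_left_right_inverse by blast
  then have "v = \<Phi> *v (\<Psi> *v v)"
    by (simp add: matrix_vector_mul_assoc)
  also have "\<dots> = (\<Sum>\<nu>\<in>UNIV. bil (\<psi> \<nu>) v *s \<phi> \<nu>)"
    by (simp add: vec_eq_iff \<Phi>_def \<Psi>_def matrix_vector_mult_def bil_def mult.commute)
  finally show ?thesis by simp
qed

lemma bil_expansion:
  assumes "eigensystem P lam \<phi> \<psi>"
  shows "bil (\<psi> \<nu>) (\<Sum>\<mu>\<in>UNIV. c \<mu> *s \<phi> \<mu>) = c \<nu>"
proof -
  have "bil (\<psi> \<nu>) (\<phi> \<mu>) = (if \<nu> = \<mu> then 1 else 0)" for \<mu>
    using assms by (simp add: eigensystem_def)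
  then show ?thesis
    by (simp add: bil_sum_right bil_scale_right mult_delta_right)
qed

text \<open>The dual modes of an eigenbasis are the rows of the inverse of the matrix whose columns are
  the basis.\<close>

lemma eigensystem_of_eigenbasis:
  fixes P :: "real^'t^'t"
  assumes \<phi>: "\<And>\<nu>. cmat P *v \<phi> \<nu> = lam \<nu> *s \<phi> \<nu>"
    and span: "vec.span (range \<phi>) = UNIV"
  shows "\<exists>\<psi>. eigensystem P lam \<phi> \<psi>"
proof -
  define \<Phi> where "\<Phi> = (\<chi> i \<nu>. \<phi> \<nu> $ i)"
  have "column \<nu> \<Phi> = \<phi> \<nu>" for \<nu>
    by (simp add: column_def \<Phi>_def vec_eq_iff)
  then have "columns \<Phi> = range \<phi>"
    by (auto simp: columns_def)
  then obtain \<Psi> where \<Phi>\<Psi>: "\<Phi> ** \<Psi> = mat 1"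
    using span matrix_right_invertible_span_columns[of \<Phi>] by auto
  then have \<Psi>\<Phi>: "\<Psi> ** \<Phi> = mat 1"
    using matrix_left_right_inverse by blast
  define D where "D = (\<chi> i j. if i = j then lam i else 0)"
  have P\<Phi>: "cmat P ** \<Phi> = \<Phi> ** D"
  proof -
    have "(cmat P ** \<Phi>) $ i $ \<nu> = (\<Phi> ** D) $ i $ \<nu>" for i \<nu>
    proof -
      have "(cmat P ** \<Phi>) $ i $ \<nu> = (cmat P *v \<phi> \<nu>) $ i"
        by (simp add: matrix_matrix_mult_def matrix_vector_mult_def \<Phi>_def)
      also have "\<dots> = (\<Phi> ** D) $ i $ \<nu>"
        by (simp add: \<phi> matrix_matrix_mult_def \<Phi>_def D_def if_distrib mult.commute cong: if_cong)
      finally show ?thesis .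
    qed
    then show ?thesis by (simp add: vec_eq_iff)
  qed
  have "\<Psi> ** cmat P = \<Psi> ** (cmat P ** \<Phi>) ** \<Psi>"
    by (metis \<Phi>\<Psi> matrix_mul_assoc matrix_mul_rid)
  also have "\<dots> = D ** \<Psi>"
    by (metis P\<Phi> \<Psi>\<Phi> matrix_mul_assoc matrix_mul_lid)
  finally have \<Psi>P: "\<Psi> ** cmat P = D ** \<Psi>" .
  have "(\<Psi> $ \<nu>) v* cmat P = lam \<nu> *s (\<Psi> $ \<nu>)" for \<nu>
  proof -
    have "((\<Psi> $ \<nu>) v* cmat P) $ i = (\<Psi> ** cmat P) $ \<nu> $ i" for i
      by (simp add: vector_matrix_mult_def matrix_matrix_mult_def mult.commute)
    moreover have "(D ** \<Psi>) $ \<nu> $ i = lam \<nu> * \<Psi> $ \<nu> $ i" for i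
      by (simp add: matrix_matrix_mult_def D_def mult_delta_left)
    ultimately show ?thesis
      by (simp add: vec_eq_iff \<Psi>P)
  qed
  moreover have "bil (\<Psi> $ \<nu>) (\<phi> \<mu>) = (if \<nu> = \<mu> then 1 else 0)" for \<nu> \<mu>
  proof -
    have "bil (\<Psi> $ \<nu>) (\<phi> \<mu>) = (\<Psi> ** \<Phi>) $ \<nu> $ \<mu>"
      by (simp add: bil_def matrix_matrix_mult_def \<Phi>_def)
    then show ?thesis by (simp add: \<Psi>\<Phi> mat_def)
  qed
  ultimately show ?thesis
    using \<phi> unfolding eigensystem_def by (intro exI[of _ "\<lambda>\<nu>. \<Psi> $ \<nu>"]) auto
qed

lemma diagonalizable_span_eigenvectors:
  fixes A :: "complex^'n^'n"
  assumes "diagonalizable A"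
  shows "vec.span {f. \<exists>l. A *v f = l *s f} = UNIV"
proof -
  obtain S D :: "complex^'n^'n" where S: "invertible S" and D: "\<forall>i j. i \<noteq> j \<longrightarrow> D $ i $ j = 0"
    and A: "A = S ** D ** matrix_inv S"
    using assms unfolding diagonalizable_def by blast
  obtain S' where SS': "S ** S' = mat 1"
    using S by (auto simp: invertible_def)
  then have inv: "matrix_inv S = S'" by (rule matrix_inv_eqI)
  have AS: "A ** S = S ** D"
    using SS' matrix_left_right_inverse[of S S']
    by (simp add: A inv flip: matrix_mul_assoc)
  have "A *v column j S = D $ j $ j *s column j S" for j
  proof -
    have "(A *v column j S) $ i = (A ** S) $ i $ j" for i
      by (simp add: matrix_vector_mult_def matrix_matrix_mult_def column_def)
    moreover have "(S ** D) $ i $ j = D $ j $ j * S $ i $ j" for i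
    proof -
      have "(S ** D) $ i $ j = (\<Sum>k\<in>UNIV. if k = j then D $ j $ j * S $ i $ j else 0)"
        unfolding matrix_matrix_mult_def vec_lambda_beta
        by (rule sum.cong) (auto simp: D)
      then show ?thesis by simp
    qed
    ultimately show ?thesis
      by (simp add: vec_eq_iff AS column_def)
  qed
  then have "columns S \<subseteq> {f. \<exists>l. A *v f = l *s f}"
    by (auto simp: columns_def)
  moreover have "vec.span (columns S) = UNIV"
    using SS' matrix_right_invertible_span_columns by blast
  ultimately show ?thesis
    using vec.span_mono by blast
qed


section \<open>The twisted reflection\<close>

locale twisted_reflection =
  fixes \<sigma> :: "'t::finite \<Rightarrow> 't" and \<kappa> :: "'t \<Rightarrow> real" and K :: real
  assumes invol: "\<sigma> (\<sigma> z) = z"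
    and pos: "0 < \<kappa> z"
    and const: "\<kappa> z * \<kappa> (\<sigma> z) = K"
begin

abbreviation M :: "real^'t^'t" where "M \<equiv> Delta2Refl \<sigma> \<kappa>"

lemma K_pos: "0 < K"
  using const pos by (metis mult_pos_pos)

lemma sum_invol: "(\<Sum>z\<in>UNIV. f (\<sigma> z)) = (\<Sum>z\<in>UNIV. f z)"
  by (rule sum.reindex_bij_witness[of _ \<sigma> \<sigma>]) (auto simp: invol)

lemma Delta_sq_mult_vec: "((Delta \<kappa> ** Delta \<kappa>) *v f) $ z = \<kappa> z * f $ z"
proof -
  have "(Delta \<kappa> *v g) $ z = sqrt (\<kappa> z) * g $ z" for g z
    by (simp add: Delta_def matrix_vector_mult_def mult_delta_left)
  then show ?thesis
    using pos[of z] by (simp flip: matrix_vector_mul_assoc)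
qed

lemma Refl_mult_vec: "(Refl \<sigma> *v f) $ z = f $ \<sigma> z"
  by (simp add: Refl_def matrix_vector_mult_def mult_delta_left)

lemma M_mult_vec: "(M *v f) $ z = \<kappa> z * f $ \<sigma> z"
  unfolding Delta2Refl_def matrix_vector_mul_assoc[of "Delta \<kappa> ** Delta \<kappa>", symmetric]
  by (simp add: Delta_sq_mult_vec Refl_mult_vec)

lemma M_nth: "M $ z $ w = (if w = \<sigma> z then \<kappa> z else 0)"
proof -
  have "M $ z $ w = (M *v axis w 1) $ z"
    by (simp add: matrix_vector_mult_basis column_def)
  then show ?thesis
    by (simp add: M_mult_vec axis_def)
qed

lemma cmat_M_mult_vec: "(cmat M *v f) $ z = of_real (\<kappa> z) * f $ \<sigma> z"
  by (simp add: cmat_def M_nth matrix_vector_mult_def if_distrib if_distribR cong: if_cong)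

lemma cmat_M_M: "cmat M *v (cmat M *v f) = of_real K *s f"
  by (simp add: vec_eq_iff cmat_M_mult_vec invol mult.assoc[symmetric] const flip: of_real_mult)

lemma twisted_pairing_iff: "twisted_pairing \<sigma> \<kappa> b0 b1 \<longleftrightarrow> b1 = M *v b0"
  by (simp add: twisted_pairing_def vec_eq_iff M_mult_vec)

lemma resolvent_symmetry_iff:
  "resolvent_symmetry \<sigma> \<kappa> P \<longleftrightarrow> (\<forall>\<gamma>\<in>{0<..<1}. commutator M (resolvent P \<gamma>) = 0)"
proof -
  define D where "D = Delta \<kappa> ** Delta \<kappa>"
  define D' where "D' = (\<chi> z w. if z = w then inverse (\<kappa> z) else 0)"
  have D': "(D' *v f) $ z = inverse (\<kappa> z) * f $ z" for f z
    by (simp add: D'_def matrix_vector_mult_def mult_delta_left)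
  have DD': "D ** D' = mat 1"
  proof -
    have "(D *v (D' *v f)) $ z = f $ z" for f z
      using pos[of z] by (simp add: D_def Delta_sq_mult_vec D')
    then show ?thesis
      by (simp add: matrix_eq vec_eq_iff flip: matrix_vector_mul_assoc)
  qed
  have D'D: "D' ** D = mat 1"
    using DD' matrix_left_right_inverse by blast
  have RR: "Refl \<sigma> ** Refl \<sigma> = mat 1"
    by (simp add: matrix_eq vec_eq_iff Refl_mult_vec invol flip: matrix_vector_mul_assoc)
  have M: "M = D ** Refl \<sigma>"
    by (simp add: Delta2Refl_def D_def)
  have "Refl \<sigma> ** G ** Refl \<sigma> = matrix_inv D ** G ** D \<longleftrightarrow> commutator M G = 0" for G
  proof -
    have "Refl \<sigma> ** G ** Refl \<sigma> = D' ** G ** D \<longleftrightarrow> D ** Refl \<sigma> ** G = G ** (D ** Refl \<sigma>)"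
    proof
      assume "Refl \<sigma> ** G ** Refl \<sigma> = D' ** G ** D"
      then have "D ** (Refl \<sigma> ** G ** Refl \<sigma>) ** Refl \<sigma> = D ** (D' ** G ** D) ** Refl \<sigma>"
        by simp
      then show "D ** Refl \<sigma> ** G = G ** (D ** Refl \<sigma>)"
        by (metis DD' RR matrix_mul_assoc matrix_mul_lid matrix_mul_rid)
    next
      assume "D ** Refl \<sigma> ** G = G ** (D ** Refl \<sigma>)"
      then have "D' ** (D ** Refl \<sigma> ** G) ** Refl \<sigma> = D' ** (G ** (D ** Refl \<sigma>)) ** Refl \<sigma>"
        by simp
      then show "Refl \<sigma> ** G ** Refl \<sigma> = D' ** G ** D"
        by (metis D'D RR matrix_mul_assoc matrix_mul_lid matrix_mul_rid)
    qed
    then show ?thesis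
      by (simp add: matrix_inv_eqI[OF DD'] commutator_eq_0_iff M)
  qed
  then show ?thesis
    unfolding resolvent_symmetry_def D_def by blast
qed

text \<open>Since \<open>M\<^sup>2 = K\<close>, the reversed matrix is the conjugate \<open>M P M\<^sup>-\<^sup>1\<close>; equality with \<open>P\<close> is
  therefore commutation, both globally and vector by vector.\<close>

lemma reversed_eq_conjugate: "K *\<^sub>R reversed \<sigma> \<kappa> P = M ** P ** M"
proof -
  have M': "M $ w $ z = (if w = \<sigma> z then \<kappa> (\<sigma> z) else 0)" for z w
    using invol by (auto simp: M_nth)
  have "(M ** P) $ z $ w = \<kappa> z * P $ \<sigma> z $ w" for z w
    by (simp add: matrix_matrix_mult_def M_nth mult_delta_left)
  then have "(M ** P ** M) $ z $ w = \<kappa> z * P $ \<sigma> z $ \<sigma> w * \<kappa> (\<sigma> w)" for z w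
    by (simp add: matrix_matrix_mult_def[of "M ** P"] M' if_distrib cong: if_cong)
  moreover have "K * (\<kappa> z / \<kappa> w * p) = \<kappa> z * p * \<kappa> (\<sigma> w)" for z w p
    using pos[of w] by (simp add: field_simps flip: const[of w])
  ultimately show ?thesis
    by (simp add: vec_eq_iff reversed_def)
qed

lemma reversed_on_vector_iff:
  "cmat P *v f = cmat (reversed \<sigma> \<kappa> P) *v f \<longleftrightarrow> cmat (commutator M P) *v f = cmat 0 *v f"
proof -
  have K: "complex_of_real K \<noteq> 0"
    using K_pos by simp
  have cancel: "complex_of_real K *s x = complex_of_real K *s y \<longleftrightarrow> x = y" for x y :: "complex^'t"
    using K by simp
  have rev: "of_real K *s (cmat (reversed \<sigma> \<kappa> P) *v f) = cmat M *v (cmat P *v (cmat M *v f))"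
    by (simp add: reversed_eq_conjugate cmat_mult matrix_vector_mul_assoc matrix_mul_assoc
        flip: cmat_scaleR_mult_vec)
  have M_cancel: "cmat M *v x = cmat M *v y \<longleftrightarrow> x = y" for x y
    by (metis cancel cmat_M_M)
  have "cmat P *v f = cmat (reversed \<sigma> \<kappa> P) *v f \<longleftrightarrow>
        cmat M *v (cmat M *v (cmat P *v f)) = cmat M *v (cmat P *v (cmat M *v f))"
    by (metis cancel rev cmat_M_M)
  then show ?thesis
    by (simp add: M_cancel cmat_commutator_eq_0_iff)
qed

lemma sk_reversible_iff: "sk_reversible \<sigma> \<kappa> P \<longleftrightarrow> commutator M P = 0"
proof -
  have "sk_reversible \<sigma> \<kappa> P \<longleftrightarrow> eq_on UNIV P (reversed \<sigma> \<kappa> P)"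
    by (simp add: sk_reversible_def eq_on_UNIV_iff vec_eq_iff)
  also have "\<dots> \<longleftrightarrow> eq_on UNIV (commutator M P) 0"
    by (simp add: eq_on_def reversed_on_vector_iff)
  finally show ?thesis
    by (simp add: eq_on_UNIV_iff)
qed


section \<open>The reset-neutral coupling\<close>

text \<open>Reset neutrality says that \<open>\<pi> \<surd>\<kappa>\<close> is \<open>\<sigma>\<close>-invariant, which makes \<open>\<pi>\<close> a left eigenvector of
  \<open>\<Delta>\<^sup>2\<R>\<close> with eigenvalue \<open>\<surd>K\<close>.\<close>

lemma reset_neutral_inner:
  assumes \<pi>: "reset_neutral \<sigma> \<kappa> z \<pi>"
  shows "\<pi> \<bullet> (M *v u) = sqrt K * (\<pi> \<bullet> u)"
proof -
  have supp: "\<pi> $ w = 0" if "w \<notin> {z, \<sigma> z}" for w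
    using \<pi> that by (auto simp: reset_neutral_def)
  have ratio: "\<pi> $ z / \<pi> $ \<sigma> z = sqrt (\<kappa> (\<sigma> z)) / sqrt (\<kappa> z)"
    using \<pi> by (simp add: reset_neutral_def)
  have "sqrt (\<kappa> (\<sigma> z)) / sqrt (\<kappa> z) > 0"
    using pos by simp
  then have "\<pi> $ \<sigma> z \<noteq> 0"
    unfolding ratio[symmetric] by auto
  then have base: "\<pi> $ z * sqrt (\<kappa> z) = \<pi> $ \<sigma> z * sqrt (\<kappa> (\<sigma> z))"
    using ratio pos[of z] by (simp add: field_simps)
  have sym: "\<pi> $ w * sqrt (\<kappa> w) = \<pi> $ \<sigma> w * sqrt (\<kappa> (\<sigma> w))" for w
  proof -
    consider "w = z" | "w = \<sigma> z" | "w \<notin> {z, \<sigma> z}" by auto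
    then show ?thesis
    proof cases
      case 3
      then have "\<sigma> w \<notin> {z, \<sigma> z}"
        by (metis insert_iff invol singletonD)
      then show ?thesis using 3 supp by simp
    qed (use base in \<open>simp_all add: invol\<close>)
  qed
  have "\<pi> $ w * \<kappa> w = sqrt K * \<pi> $ \<sigma> w" for w
  proof -
    have "\<pi> $ w * \<kappa> w = \<pi> $ w * sqrt (\<kappa> w) * sqrt (\<kappa> w)"
      using pos[of w] by simp
    also have "\<dots> = \<pi> $ \<sigma> w * (sqrt (\<kappa> w) * sqrt (\<kappa> (\<sigma> w)))"
      unfolding sym[of w] by (simp add: mult_ac)
    also have "sqrt (\<kappa> w) * sqrt (\<kappa> (\<sigma> w)) = sqrt K"
      by (simp add: const flip: real_sqrt_mult)
    finally show ?thesis by simp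
  qed
  then have "\<pi> \<bullet> (M *v u) = (\<Sum>w\<in>UNIV. sqrt K * \<pi> $ \<sigma> w * u $ \<sigma> w)"
    by (simp add: inner_vec_def M_mult_vec flip: mult.assoc)
  also have "\<dots> = sqrt K * (\<pi> \<bullet> u)"
    using sum_invol[of "\<lambda>w. sqrt K * \<pi> $ w * u $ w"]
    by (simp add: inner_vec_def sum_distrib_left mult.assoc)
  finally show ?thesis .
qed

text \<open>The commutation of \<open>\<Delta>\<^sup>2\<R>\<close> with the resolvent is required on the flux \<open>b0\<close> only, so that the
  conclusion is available on the span of the active modes as well.\<close>

lemma universal_couplingI:
  assumes P: "substochastic P" and irr: "irreducible_matrix P"
    and b0: "\<And>z. 0 \<le> b0 $ z" "b0 \<noteq> 0" and b1: "b1 = M *v b0"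
    and comm: "\<And>\<gamma>. \<gamma> \<in> {0<..<1} \<Longrightarrow> M *v (resolvent P \<gamma> *v b0) = resolvent P \<gamma> *v (M *v b0)"
  shows "universal_coupling \<sigma> \<kappa> K P b0 b1"
  unfolding universal_coupling_def
proof (intro allI ballI impI)
  fix z \<pi> and \<gamma> :: real
  assume \<gamma>: "\<gamma> \<in> {0<..<1}" and \<pi>: "reset_neutral \<sigma> \<kappa> z \<pi>"
  define u where "u = resolvent P \<gamma> *v b0"
  have "resolvent P \<gamma> *v (b0 + b1) = u + M *v u"
    by (simp add: u_def comm[OF \<gamma>] b1 matrix_vector_right_distrib)
  then have denom: "\<pi> \<bullet> (resolvent P \<gamma> *v (b0 + b1)) = (1 + sqrt K) * (\<pi> \<bullet> u)"
    by (simp add: inner_add_right reset_neutral_inner[OF \<pi>] algebra_simps)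
  have "0 < \<pi> \<bullet> u"
  proof -
    have \<pi>0: "0 \<le> \<pi> $ w" and \<pi>1: "(\<Sum>w\<in>UNIV. \<pi> $ w) = 1" for w
      using \<pi> by (auto simp: reset_neutral_def)
    obtain w where "\<pi> $ w \<noteq> 0"
      using \<pi>1 by (metis sum.neutral zero_neq_one)
    moreover have u: "0 < u $ x" for x
      unfolding u_def by (rule resolvent_pos[OF P irr \<gamma> b0])
    ultimately have "0 < \<pi> $ w * u $ w"
      using \<pi>0[of w] by simp
    also have "\<dots> \<le> \<pi> \<bullet> u"
      using member_le_sum[of w UNIV "\<lambda>x. \<pi> $ x * u $ x"] \<pi>0 u
      by (simp add: inner_vec_def less_imp_le)
    finally show ?thesis .
  qed
  then show "coupling P b0 b1 \<pi> \<gamma> = 1 / (1 + sqrt K)"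
    unfolding coupling_def denom by (simp add: u_def)
qed


section \<open>Spectral duality on the active modes\<close>

text \<open>The duality for a mode \<open>\<nu>\<close> is the vector identity
  \<open>(\<psi>\<^sub>\<nu>\<^sup>T b1) \<phi>\<^sub>\<nu> = (\<psi>\<^sub>\<nu>\<^sup>T b0) M \<phi>\<^sub>\<nu>\<close>.\<close>

lemma spectral_duality_iff:
  "spectral_duality \<sigma> \<kappa> \<phi> \<psi> b0 b1 \<longleftrightarrow>
     (\<forall>\<nu>. bil (\<psi> \<nu>) (cvec b1) *s \<phi> \<nu> = bil (\<psi> \<nu>) (cvec b0) *s (cmat M *v \<phi> \<nu>))"
  by (simp add: spectral_duality_def spec_coeff_def vec_eq_iff cmat_M_mult_vec mult_ac)

text \<open>Summing the vector identities over all modes and using completeness gives \<open>b1 = M b0\<close>; the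
  inactive modes enter here, as they must have no component along \<open>b1\<close>.\<close>

lemma spectral_duality_imp_twisted_pairing:
  assumes es: "eigensystem P lam \<phi> \<psi>" and dual: "spectral_duality \<sigma> \<kappa> \<phi> \<psi> b0 b1"
  shows "twisted_pairing \<sigma> \<kappa> b0 b1"
proof -
  have "cvec b1 = (\<Sum>\<nu>\<in>UNIV. bil (\<psi> \<nu>) (cvec b1) *s \<phi> \<nu>)"
    by (simp add: eigensystem_expansion[OF es])
  also have "\<dots> = (\<Sum>\<nu>\<in>UNIV. cmat M *v (bil (\<psi> \<nu>) (cvec b0) *s \<phi> \<nu>))"
    using dual by (simp add: spectral_duality_iff vector_scalar_commute)
  also have "\<dots> = cmat M *v (\<Sum>\<nu>\<in>UNIV. bil (\<psi> \<nu>) (cvec b0) *s \<phi> \<nu>)"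
    by (simp add: vec.linear_sum)
  also have "\<dots> = cvec (M *v b0)"
    by (simp add: eigensystem_expansion[OF es] cmat_mult_cvec)
  finally show ?thesis
    by (simp add: twisted_pairing_iff cvec_inject)
qed

lemma eq_on_active_span_iff:
  "eq_on (active_span \<phi> \<psi> b0) X Y \<longleftrightarrow>
     (\<forall>\<nu>. active \<psi> b0 \<nu> \<longrightarrow> cmat X *v \<phi> \<nu> = cmat Y *v \<phi> \<nu>)"
  by (auto simp: active_span_def eq_on_span_iff)

lemma commute_on_mode_iff:
  assumes "eigensystem P lam \<phi> \<psi>"
  shows "cmat (commutator M P) *v \<phi> \<nu> = cmat 0 *v \<phi> \<nu> \<longleftrightarrow>
         cmat P *v (cmat M *v \<phi> \<nu>) = lam \<nu> *s (cmat M *v \<phi> \<nu>)"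
  using assms
  by (auto simp: cmat_commutator_eq_0_iff eigensystem_def vector_scalar_commute)

text \<open>For an active mode the duality makes \<open>M \<phi>\<^sub>\<nu>\<close> a multiple of \<open>\<phi>\<^sub>\<nu>\<close>.\<close>

lemma spectral_duality_imp_commute:
  assumes es: "eigensystem P lam \<phi> \<psi>" and dual: "spectral_duality \<sigma> \<kappa> \<phi> \<psi> b0 b1"
  shows "eq_on (active_span \<phi> \<psi> b0) (commutator M P) 0"
  unfolding eq_on_active_span_iff
proof (intro allI impI)
  fix \<nu> assume "active \<psi> b0 \<nu>"
  then have act: "bil (\<psi> \<nu>) (cvec b0) \<noteq> 0"
    by (simp add: active_def)
  have "bil (\<psi> \<nu>) (cvec b1) *s \<phi> \<nu> = bil (\<psi> \<nu>) (cvec b0) *s (cmat M *v \<phi> \<nu>)"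
    using dual by (simp add: spectral_duality_iff)
  then obtain c where c: "cmat M *v \<phi> \<nu> = c *s \<phi> \<nu>"
    by (metis act left_inverse vector_smult_assoc vector_smult_lid)
  have "cmat P *v \<phi> \<nu> = lam \<nu> *s \<phi> \<nu>"
    using es by (simp add: eigensystem_def)
  then show "cmat (commutator M P) *v \<phi> \<nu> = cmat 0 *v \<phi> \<nu>"
    unfolding commute_on_mode_iff[OF es] by (simp add: c vector_scalar_commute vec_eq_iff)
qed

text \<open>In an adapted system \<open>M \<phi>\<^sub>\<nu> = c\<^sub>\<nu> \<phi>\<^sub>\<nu>\<close> for every active \<open>\<nu>\<close>. As \<open>b0\<close> is a combination of
  active modes, \<open>b1 = M b0\<close> has the coefficients \<open>c\<^sub>\<nu> (\<psi>\<^sub>\<nu>\<^sup>T b0)\<close>, which is the duality.\<close>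

lemma commute_imp_spectral_duality:
  assumes es: "eigensystem P lam \<phi> \<psi>" and ad: "adapted \<sigma> \<kappa> P lam \<phi>"
    and tw: "twisted_pairing \<sigma> \<kappa> b0 b1"
    and comm: "eq_on (active_span \<phi> \<psi> b0) (commutator M P) 0"
  shows "spectral_duality \<sigma> \<kappa> \<phi> \<psi> b0 b1"
proof -
  have "\<exists>c. active \<psi> b0 \<nu> \<longrightarrow> cmat M *v \<phi> \<nu> = c *s \<phi> \<nu>" for \<nu>
    using ad comm by (auto simp: adapted_def Let_def eq_on_active_span_iff commute_on_mode_iff[OF es])
  then obtain c where c: "\<And>\<nu>. active \<psi> b0 \<nu> \<Longrightarrow> cmat M *v \<phi> \<nu> = c \<nu> *s \<phi> \<nu>"
    by metis
  have mode: "bil (\<psi> \<nu>) (cvec b0) *s (cmat M *v \<phi> \<nu>) = (bil (\<psi> \<nu>) (cvec b0) * c \<nu>) *s \<phi> \<nu>" for \<nu>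
    by (cases "active \<psi> b0 \<nu>") (auto simp: c active_def)
  have "cvec b1 = cmat M *v (\<Sum>\<nu>\<in>UNIV. bil (\<psi> \<nu>) (cvec b0) *s \<phi> \<nu>)"
    using tw by (simp add: eigensystem_expansion[OF es] cmat_mult_cvec twisted_pairing_iff)
  also have "\<dots> = (\<Sum>\<nu>\<in>UNIV. (bil (\<psi> \<nu>) (cvec b0) * c \<nu>) *s \<phi> \<nu>)"
    by (simp add: vec.linear_sum vector_scalar_commute mode)
  finally have "bil (\<psi> \<nu>) (cvec b1) = bil (\<psi> \<nu>) (cvec b0) * c \<nu>" for \<nu>
    by (simp add: bil_expansion[OF es])
  then show ?thesis
    by (simp add: spectral_duality_iff mode)
qed

text \<open>This is what lets commutation on the active modes alone determine the coupling.\<close>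

lemma cvec_in_active_span:
  assumes es: "eigensystem P lam \<phi> \<psi>"
  shows "cvec b0 \<in> active_span \<phi> \<psi> b0"
proof -
  have "bil (\<psi> \<nu>) (cvec b0) *s \<phi> \<nu> \<in> active_span \<phi> \<psi> b0" for \<nu>
  proof (cases "active \<psi> b0 \<nu>")
    case True
    then show ?thesis
      unfolding active_span_def by (intro vec.span_scale vec.span_base) auto
  next
    case False
    then show ?thesis
      by (simp add: active_def active_span_def vec.span_zero)
  qed
  then have "(\<Sum>\<nu>\<in>UNIV. bil (\<psi> \<nu>) (cvec b0) *s \<phi> \<nu>) \<in> active_span \<phi> \<psi> b0"
    unfolding active_span_def by (intro vec.span_sum)
  then show ?thesis
    by (simp add: eigensystem_expansion[OF es])
qed

lemma active_span_UNIV: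
  assumes es: "eigensystem P lam \<phi> \<psi>" and act: "\<forall>\<nu>. active \<psi> b0 \<nu>"
  shows "active_span \<phi> \<psi> b0 = UNIV"
proof -
  have "v \<in> active_span \<phi> \<psi> b0" for v
  proof -
    have "(\<Sum>\<nu>\<in>UNIV. bil (\<psi> \<nu>) v *s \<phi> \<nu>) \<in> active_span \<phi> \<psi> b0"
      unfolding active_span_def using act
      by (intro vec.span_sum vec.span_scale vec.span_base) auto
    then show ?thesis
      by (simp add: eigensystem_expansion[OF es])
  qed
  then show ?thesis by blast
qed

lemma resolvent_commute_on_active_span_iff:
  assumes P: "substochastic P" and es: "eigensystem P lam \<phi> \<psi>" and \<gamma>: "\<gamma> \<in> {0<..<1}"
  shows "eq_on (active_span \<phi> \<psi> b0) (commutator M (resolvent P \<gamma>)) 0 \<longleftrightarrow>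
         eq_on (active_span \<phi> \<psi> b0) (commutator M P) 0"
proof -
  have "cmat P *v \<phi> \<nu> = lam \<nu> *s \<phi> \<nu>" for \<nu>
    using es by (simp add: eigensystem_def)
  from commute_resolvent_on_eigenvector_iff[OF P \<gamma> this] show ?thesis
    by (simp add: eq_on_active_span_iff)
qed


section \<open>Existence of adapted eigensystems\<close>

text \<open>If \<open>f\<close> and \<open>M f\<close> lie in the same eigenspace of \<open>P\<close>, then so do \<open>M f \<plusminus> \<surd>K f\<close>. By \<open>M\<^sup>2 = K\<close>
  these are eigenvectors of \<open>M\<close>, and \<open>f\<close> is a combination of them.\<close>

lemma in_span_joint_eigenvectors:
  assumes f: "cmat P *v f = l *s f" and Mf: "cmat P *v (cmat M *v f) = l *s (cmat M *v f)"
  shows "f \<in> vec.span {g. (\<exists>l. cmat P *v g = l *s g) \<and> (\<exists>c. cmat M *v g = c *s g)}"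
    (is "f \<in> vec.span ?J")
proof -
  define r where "r = complex_of_real (sqrt K)"
  have rr: "r * r = of_real K" and r0: "r \<noteq> 0"
    using K_pos by (simp_all add: r_def flip: of_real_mult)
  have joint: "cmat M *v f + s *s f \<in> ?J" if s: "s * s = of_real K" for s
  proof -
    have "cmat P *v (cmat M *v f + s *s f) = l *s (cmat M *v f + s *s f)"
      by (simp add: matrix_vector_right_distrib vector_scalar_commute f Mf vec_eq_iff algebra_simps)
    moreover have "cmat M *v (cmat M *v f + s *s f) = s *s (cmat M *v f + s *s f)"
      by (simp add: matrix_vector_right_distrib vector_scalar_commute cmat_M_M vec_eq_iff
          algebra_simps flip: s)
    ultimately show ?thesis by blast
  qed
  have "f = (1 / (2 * r)) *s ((cmat M *v f + r *s f) - (cmat M *v f + (- r) *s f))"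
    using r0 by (simp add: vec_eq_iff field_simps)
  also have "\<dots> \<in> vec.span ?J"
    using joint[of r] joint[of "- r"] rr
    by (intro vec.span_scale vec.span_diff vec.span_base) auto
  finally show ?thesis .
qed

text \<open>A maximal independent set of joint eigenvectors of \<open>P\<close> and \<open>M\<close> is extended to a basis by
  eigenvectors of \<open>P\<close>. A basis vector that \<open>M\<close> maps into its own eigenspace is in the span of the
  joint eigenvectors, so by independence it is one of the vectors of the initial set.\<close>

lemma adapted_eigensystem_exists:
  assumes diag: "diagonalizable (cmat P)"
  shows "\<exists>lam \<phi> \<psi>. eigensystem P lam \<phi> \<psi> \<and> adapted \<sigma> \<kappa> P lam \<phi>"
proof -
  define E where "E = {f. \<exists>l. cmat P *v f = l *s f}"
  define J where "J = {g. (\<exists>l. cmat P *v g = l *s g) \<and> (\<exists>c. cmat M *v g = c *s g)}"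
  obtain B1 where B1: "B1 \<subseteq> J" "vec.independent B1" "J \<subseteq> vec.span B1"
    using vec.maximal_independent_subset by metis
  have "B1 \<subseteq> E"
    using B1 by (auto simp: J_def E_def)
  then obtain B where B: "B1 \<subseteq> B" "B \<subseteq> E" "vec.independent B" "E \<subseteq> vec.span B"
    using vec.maximal_independent_subset_extend B1(2) by metis
  have "vec.span E = UNIV"
    unfolding E_def by (rule diagonalizable_span_eigenvectors[OF diag])
  then have span: "vec.span B = UNIV"
    using B(4) by (metis top.extremum_uniqueI vec.span_mono vec.span_span)
  have fin: "finite B"
    using B(3) by (rule vec.finiteI_independent)
  have "card B = CARD('t)"
    using vec.basis_card_eq_dim[of B UNIV] span B(3) by (simp add: vec_dim_card del: vec.dim_UNIV)
  then obtain \<phi> :: "'t \<Rightarrow> complex^'t" where \<phi>: "bij_betw \<phi> UNIV B"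
    using fin by (metis finite_same_card_bij finite_class.finite_UNIV)
  have range: "range \<phi> = B"
    using \<phi> by (simp add: bij_betw_def)
  then have "\<exists>l. cmat P *v \<phi> \<nu> = l *s \<phi> \<nu>" for \<nu>
    using B(2) by (auto simp: E_def)
  then obtain lam where lam: "\<And>\<nu>. cmat P *v \<phi> \<nu> = lam \<nu> *s \<phi> \<nu>"
    by metis
  obtain \<psi> where "eigensystem P lam \<phi> \<psi>"
    using eigensystem_of_eigenbasis[of P \<phi> lam] lam span range by auto
  moreover have "adapted \<sigma> \<kappa> P lam \<phi>"
    unfolding adapted_def Let_def
  proof (intro allI impI)
    fix \<nu>
    assume "cmat P *v (cmat M *v \<phi> \<nu>) = lam \<nu> *s (cmat M *v \<phi> \<nu>)"
    then have "\<phi> \<nu> \<in> vec.span J"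
      unfolding J_def using lam by (intro in_span_joint_eigenvectors)
    then have in_span: "\<phi> \<nu> \<in> vec.span B1"
      using B1(3) by (metis in_mono vec.span_mono vec.span_span)
    have "\<phi> \<nu> \<in> B1"
    proof (rule ccontr)
      assume "\<phi> \<nu> \<notin> B1"
      then have "B1 \<subseteq> B - {\<phi> \<nu>}"
        using B(1) by blast
      then have "\<phi> \<nu> \<in> vec.span (B - {\<phi> \<nu>})"
        using in_span vec.span_mono by blast
      then show False
        using B(3) range by (metis rangeI vec.dependent_def)
    qed
    then show "\<exists>c. cmat M *v \<phi> \<nu> = c *s \<phi> \<nu>"
      using B1(1) by (auto simp: J_def)
  qed
  ultimately show ?thesis by blast
qed

end


section \<open>The equivalence and the universal coupling\<close>

theorem mainTheorem1:
  fixes Q :: "real^('t::finite + 'd::finite)^('t + 'd)"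
    and D0 D1 :: "'d set"
    and P :: "real^'t^'t" and b0 b1 :: "real^'t"
    and \<sigma> :: "'t \<Rightarrow> 't" and \<kappa> :: "'t \<Rightarrow> real" and K :: real
  assumes chain: "absorbing_chain Q D0 D1"
    and P: "P = trans_part Q" and b0: "b0 = bflux Q D0" and b1: "b1 = bflux Q D1"
    and diag: "diagonalizable (cmat P)"
    and invol: "\<forall>z. \<sigma> (\<sigma> z) = z"
    and pos: "\<forall>z. 0 < \<kappa> z"
    and const: "\<forall>z. \<kappa> z * \<kappa> (\<sigma> z) = K"
  shows
    \<comment> \<open>(b), (c), (d) as identities on all functions\<close>
    "(resolvent_symmetry \<sigma> \<kappa> P \<longleftrightarrow>
        (\<forall>\<gamma>\<in>{0<..<1}. commutator (Delta2Refl \<sigma> \<kappa>) (resolvent P \<gamma>) = 0)) \<and>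
     (resolvent_symmetry \<sigma> \<kappa> P \<longleftrightarrow> commutator (Delta2Refl \<sigma> \<kappa>) P = 0) \<and>
     (commutator (Delta2Refl \<sigma> \<kappa>) P = 0 \<longleftrightarrow> sk_reversible \<sigma> \<kappa> P) \<and>
     (commutator (Delta2Refl \<sigma> \<kappa>) P = 0 \<and> twisted_pairing \<sigma> \<kappa> b0 b1 \<longrightarrow>
        universal_coupling \<sigma> \<kappa> K P b0 b1) \<and>
     (\<exists>lam \<phi> \<psi>. eigensystem P lam \<phi> \<psi> \<and> adapted \<sigma> \<kappa> P lam \<phi>) \<and>
     (\<forall>lam \<phi> \<psi>. eigensystem P lam \<phi> \<psi> \<longrightarrow>
       (let a = spectral_duality \<sigma> \<kappa> \<phi> \<psi> b0 b1;
            V = active_span \<phi> \<psi> b0;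
            bV = (\<forall>\<gamma>\<in>{0<..<1}. eq_on V (commutator (Delta2Refl \<sigma> \<kappa>) (resolvent P \<gamma>)) 0);
            cV = eq_on V (commutator (Delta2Refl \<sigma> \<kappa>) P) 0;
            dV = eq_on V P (reversed \<sigma> \<kappa> P)
        in (a \<longrightarrow> cV \<and> twisted_pairing \<sigma> \<kappa> b0 b1) \<and>
           (bV \<longleftrightarrow> cV) \<and> (cV \<longleftrightarrow> dV) \<and>
           (adapted \<sigma> \<kappa> P lam \<phi> \<and> twisted_pairing \<sigma> \<kappa> b0 b1 \<longrightarrow> (a \<longleftrightarrow> cV)) \<and>
           ((\<forall>\<nu>. active \<psi> b0 \<nu>) \<longrightarrow>
              (bV \<longleftrightarrow> resolvent_symmetry \<sigma> \<kappa> P) \<and>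
              (cV \<longleftrightarrow> commutator (Delta2Refl \<sigma> \<kappa>) P = 0) \<and>
              (dV \<longleftrightarrow> sk_reversible \<sigma> \<kappa> P)) \<and>
           (cV \<and> twisted_pairing \<sigma> \<kappa> b0 b1 \<longrightarrow> universal_coupling \<sigma> \<kappa> K P b0 b1)))"
proof -
  interpret twisted_reflection \<sigma> \<kappa> K
    using invol pos const by unfold_locales auto
  have sub: "substochastic P" and irr: "irreducible_matrix P"
    using substochastic_trans_part[OF chain] irreducible_trans_part[OF chain] by (simp_all add: P)
  have res_iff: "(\<forall>\<gamma>\<in>{0<..<1}. commutator M (resolvent P \<gamma>) = 0) \<longleftrightarrow> commutator M P = 0"
  proof -
    have "(1/2 :: real) \<in> {0<..<1}" by simp
    then show ?thesis
      using commute_resolvent_iff[OF sub] by blast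
  qed
  have coupling: "universal_coupling \<sigma> \<kappa> K P b0 b1"
    if tw: "twisted_pairing \<sigma> \<kappa> b0 b1"
      and comm: "\<And>\<gamma>. \<gamma> \<in> {0<..<1} \<Longrightarrow> M *v (resolvent P \<gamma> *v b0) = resolvent P \<gamma> *v (M *v b0)"
  proof (rule universal_couplingI[OF sub irr _ _ _ comm])
    show b1_eq: "b1 = M *v b0"
      using tw by (simp add: twisted_pairing_iff)
    show "0 \<le> b0 $ z" for z
      using bflux_nonneg[OF chain] by (simp add: b0)
    show "b0 \<noteq> 0"
      using bflux_nonzero[OF chain] b1_eq by (auto simp flip: b0 b1)
  qed
  have coupling_all: "universal_coupling \<sigma> \<kappa> K P b0 b1"
    if "commutator M P = 0" "twisted_pairing \<sigma> \<kappa> b0 b1"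
  proof (rule coupling[OF that(2)])
    fix \<gamma> :: real assume "\<gamma> \<in> {0<..<1}"
    then have "M ** resolvent P \<gamma> = resolvent P \<gamma> ** M"
      using that(1) commute_resolvent_iff[OF sub] by (simp flip: commutator_eq_0_iff)
    then show "M *v (resolvent P \<gamma> *v b0) = resolvent P \<gamma> *v (M *v b0)"
      by (simp add: matrix_vector_mul_assoc)
  qed
  have modes: "(a \<longrightarrow> cV \<and> twisted_pairing \<sigma> \<kappa> b0 b1) \<and>
           (bV \<longleftrightarrow> cV) \<and> (cV \<longleftrightarrow> dV) \<and>
           (adapted \<sigma> \<kappa> P lam \<phi> \<and> twisted_pairing \<sigma> \<kappa> b0 b1 \<longrightarrow> (a \<longleftrightarrow> cV)) \<and>
           ((\<forall>\<nu>. active \<psi> b0 \<nu>) \<longrightarrow>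
              (bV \<longleftrightarrow> resolvent_symmetry \<sigma> \<kappa> P) \<and>
              (cV \<longleftrightarrow> commutator M P = 0) \<and>
              (dV \<longleftrightarrow> sk_reversible \<sigma> \<kappa> P)) \<and>
           (cV \<and> twisted_pairing \<sigma> \<kappa> b0 b1 \<longrightarrow> universal_coupling \<sigma> \<kappa> K P b0 b1)"
    if es: "eigensystem P lam \<phi> \<psi>"
      and a: "a = spectral_duality \<sigma> \<kappa> \<phi> \<psi> b0 b1"
      and V: "V = active_span \<phi> \<psi> b0"
      and bV: "bV = (\<forall>\<gamma>\<in>{0<..<1}. eq_on V (commutator M (resolvent P \<gamma>)) 0)"
      and cV: "cV = eq_on V (commutator M P) 0"
      and dV: "dV = eq_on V P (reversed \<sigma> \<kappa> P)"
    for lam \<phi> \<psi> a V bV cV dV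
  proof -
    have "(1/2 :: real) \<in> {0<..<1}" by simp
    then have bc: "bV \<longleftrightarrow> cV"
      unfolding bV cV V using resolvent_commute_on_active_span_iff[OF sub es] by blast
    have cd: "cV \<longleftrightarrow> dV"
      unfolding cV dV eq_on_def reversed_on_vector_iff ..
    have ac: "a \<longrightarrow> cV \<and> twisted_pairing \<sigma> \<kappa> b0 b1"
      using spectral_duality_imp_commute[OF es] spectral_duality_imp_twisted_pairing[OF es]
      by (auto simp: a cV V)
    have ca: "a" if "adapted \<sigma> \<kappa> P lam \<phi>" "twisted_pairing \<sigma> \<kappa> b0 b1" cV
      using commute_imp_spectral_duality[OF es that(1,2)] that(3) by (simp add: a cV V)
    have full: "cV \<longleftrightarrow> commutator M P = 0" if "\<forall>\<nu>. active \<psi> b0 \<nu>"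
      by (simp add: cV V active_span_UNIV[OF es that] eq_on_UNIV_iff)
    have "universal_coupling \<sigma> \<kappa> K P b0 b1" if cV "twisted_pairing \<sigma> \<kappa> b0 b1"
    proof (rule coupling[OF that(2)])
      fix \<gamma> :: real assume "\<gamma> \<in> {0<..<1}"
      then have "eq_on V (commutator M (resolvent P \<gamma>)) 0"
        using that(1) bc bV by blast
      then have "cmat M *v (cmat (resolvent P \<gamma>) *v cvec b0)
          = cmat (resolvent P \<gamma>) *v (cmat M *v cvec b0)"
        using cvec_in_active_span[OF es, of b0]
        by (auto simp: V eq_on_def cmat_commutator_eq_0_iff)
      then show "M *v (resolvent P \<gamma> *v b0) = resolvent P \<gamma> *v (M *v b0)"
        by (simp add: cmat_mult_cvec cvec_inject)
    qed
    then show ?thesis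
      using ac bc cd ca full res_iff resolvent_symmetry_iff[of P] sk_reversible_iff[of P] by blast
  qed
  have bc: "resolvent_symmetry \<sigma> \<kappa> P \<longleftrightarrow> commutator M P = 0"
    by (simp only: resolvent_symmetry_iff res_iff)
  have coupling_imp: "commutator M P = 0 \<and> twisted_pairing \<sigma> \<kappa> b0 b1 \<longrightarrow>
      universal_coupling \<sigma> \<kappa> K P b0 b1"
    using coupling_all by blast
  show ?thesis
    unfolding Let_def
    by (intro conjI[OF resolvent_symmetry_iff] conjI[OF bc] conjI[OF sk_reversible_iff[symmetric]]
        conjI[OF coupling_imp] conjI[OF adapted_eigensystem_exists[OF diag]] allI impI)
       (rule modes[OF _ refl refl refl refl refl])
qed

end
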